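(* Let $X_1$ be the subshift over the alphabet $\mathbb N^*=\{1,2,3,\dots\}$ given by $X_1=X_F$ with $F=(\mathbb N^* )^3\setminus P$, where $$P=\{(1,j,1),(j,1,j): j\in\mathbb N^*\setminus\{2\}\}\cup\{(j,j+1,j+2): j\in\mathbb N^*\},$$ and let $X_2=\{(k+j)_{j\in\mathbb N^*}: k\in\mathbb Z\}$, a subshift over the alphabet $\mathbb Z$. Then the Ott-Tomforde-Willis (OTW) subshifts associated with $X_1$ and $X_2$ are not conjugate. Moreover, there is no isometric conjugacy between $X_1$ and $X_2$ when these are equipped with the $\frac1{2^i}$-metric (which induces the product topology).
   Context: Let $\mathfrak A$ be a nonempty set (the alphabet) and let $\mathfrak A^*$ be the set of finite words over $\mathfrak A$, including the empty word $\omega$. The shift $\sigma$ on sequences deletes the first letter. For $F\subseteq\mathfrak A^*$, $X_F$ denotes the subshift consisting of all infinite sequences over $\mathfrak A$ (indexed by $\mathbb N=\{0,1,2,\dots\}$, up to re-indexing) in which no word of $F$ occurs as a block. OTW-subshifts: the OTW-subshift associated with a subshift $X$ over $\mathfrak A$ is $X^{OTW}=X\cup X^{fin}$, where $X^{fin}$ is the set of $\alpha\in\mathfrak A^*$ for which there are infinitely many $a\in\mathfrak A$ such that $\alpha a y\in X$ for some infinite sequence $y$ over $\mathfrak A$. Its topology has as basis the sets $\{y\in X^{OTW}: y \text{ begins with } \alpha \text{ and, if } |y|>|\alpha|, \text{ the letter of } y \text{ following } \alpha \text{ is not in } G\}$, for $\alpha\in\mathfrak A^*$ and finite $G\subseteq\mathfrak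 A$. The shift on $X^{OTW}$ deletes the first letter of a nonempty (finite or infinite) word and fixes $\omega$. Two OTW-subshifts are conjugate if there is a homeomorphism between them that commutes with the shifts and preserves the length (in $\mathbb N\cup\{\infty\}$) of words. The $\frac1{2^i}$-metric on a subshift is $d(x,y)=2^{-i}$ where $i$ is the least index at which $x$ and $y$ differ, and $d(x,x)=0$. An isometric conjugacy between two subshifts is a bijective isometry for these metrics that commutes with the shift maps. *)

theory Defs
  imports "HOL-Analysis.Analysis" "HOL-Library.Omega_Words_Fun"
begin

text \<open>
  The alphabet is an explicit set \<open>A\<close>; finite words over it are the elements of \<open>lists A\<close>.
  Infinite sequences have the type \<open>'a word = nat \<Rightarrow> 'a\<close> of \<open>Omega_Words_Fun\<close>, from which we also
  take \<open>\<frown>\<close> (prepending a finite word), \<open>suffix\<close> and the block \<open>x [i \<rightarrow> j] = [x i, \<dots>, x (j - 1)]\<close>.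
\<close>

section \<open>Subshifts\<close>

definition occurs_in :: "'a list \<Rightarrow> 'a word \<Rightarrow> bool" where
  "occurs_in w x \<longleftrightarrow> (\<exists>i. x [i \<rightarrow> i + length w] = w)"

definition subshift_of :: "'a set \<Rightarrow> 'a list set \<Rightarrow> 'a word set" where
  "subshift_of A F = {x. range x \<subseteq> A \<and> (\<forall>w\<in>F. \<not> occurs_in w x)}"

definition is_subshift :: "'a set \<Rightarrow> 'a word set \<Rightarrow> bool" where
  "is_subshift A X \<longleftrightarrow> (\<exists>F \<subseteq> lists A. X = subshift_of A F)"

definition shift :: "'a word \<Rightarrow> 'a word" where
  "shift x = suffix 1 x"

section \<open>Ott-Tomforde-Willis subshifts\<close>

datatype 'a fiword = Finw "'a list" | Infw "'a word"

fun wlen :: "'a fiword \<Rightarrow> enat" where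
  "wlen (Finw w) = enat (length w)"
| "wlen (Infw x) = \<infinity>"

fun letter :: "'a fiword \<Rightarrow> nat \<Rightarrow> 'a" where
  "letter (Finw w) i = w ! i"
| "letter (Infw x) i = x i"

fun begins_with :: "'a fiword \<Rightarrow> 'a list \<Rightarrow> bool" where
  "begins_with (Finw w) \<alpha> \<longleftrightarrow> (\<exists>v. w = \<alpha> @ v)"
| "begins_with (Infw x) \<alpha> \<longleftrightarrow> (\<exists>y. x = \<alpha> \<frown> y)"

text \<open>Since \<open>tl [] = []\<close>, the empty word is fixed.\<close>

fun otw_shift :: "'a fiword \<Rightarrow> 'a fiword" where
  "otw_shift (Finw w) = Finw (tl w)"
| "otw_shift (Infw x) = Infw (shift x)"

definition otw_fin :: "'a set \<Rightarrow> 'a word set \<Rightarrow> 'a list set" where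
  "otw_fin A X = {\<alpha> \<in> lists A. infinite {a \<in> A. \<exists>y. range y \<subseteq> A \<and> \<alpha> \<frown> [a] \<frown> y \<in> X}}"

definition otw :: "'a set \<Rightarrow> 'a word set \<Rightarrow> 'a fiword set" where
  "otw A X = Infw ` X \<union> Finw ` otw_fin A X"

definition otw_cylinder :: "'a set \<Rightarrow> 'a word set \<Rightarrow> 'a list \<Rightarrow> 'a set \<Rightarrow> 'a fiword set" where
  "otw_cylinder A X \<alpha> G =
     {y \<in> otw A X. begins_with y \<alpha> \<and>
        (enat (length \<alpha>) < wlen y \<longrightarrow> letter y (length \<alpha>) \<notin> G)}"

definition otw_basis :: "'a set \<Rightarrow> 'a word set \<Rightarrow> 'a fiword set set" where
  "otw_basis A X = {otw_cylinder A X \<alpha> G |\<alpha> G. \<alpha> \<in> lists A \<and> finite G \<and> G \<subseteq> A}"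

definition otw_topology :: "'a set \<Rightarrow> 'a word set \<Rightarrow> 'a fiword topology" where
  "otw_topology A X = topology (arbitrary union_of (\<lambda>U. U \<in> otw_basis A X))"

text \<open>The sets above do form a basis, so \<open>otw_topology\<close> is the intended topology.\<close>

lemma otw_basisI:
  "\<alpha> \<in> lists A \<Longrightarrow> finite G \<Longrightarrow> G \<subseteq> A \<Longrightarrow> otw_cylinder A X \<alpha> G \<in> otw_basis A X"
  unfolding otw_basis_def by blast

lemma begins_with_iff:
  "begins_with y \<alpha> \<longleftrightarrow>
     enat (length \<alpha>) \<le> wlen y \<and> (\<forall>i<length \<alpha>. letter y i = \<alpha> ! i)"
proof (cases y)
  case (Finw w)
  have "w = \<alpha> @ drop (length \<alpha>) w"
    if "length \<alpha> \<le> length w" "\<forall>i<length \<alpha>. w ! i = \<alpha> ! i"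
    using that by (intro nth_equalityI) (auto simp: nth_append)
  then show ?thesis using Finw by (auto simp: nth_append)
next
  case (Infw x)
  have "x = \<alpha> \<frown> suffix (length \<alpha>) x" if "\<forall>i<length \<alpha>. x i = \<alpha> ! i"
    using that by (auto simp: conc_def fun_eq_iff)
  then show ?thesis using Infw by (auto simp: conc_def)
qed

lemma otw_cylinder_Int_aux:
  assumes "U = otw_cylinder A X \<alpha> G" "V = otw_cylinder A X \<beta> H"
    and fin: "\<alpha> \<in> lists A" "\<beta> \<in> lists A" "finite G" "G \<subseteq> A" "finite H" "H \<subseteq> A"
    and le: "length \<alpha> \<le> length \<beta>"
  shows "U \<inter> V = {} \<or> U \<inter> V \<in> otw_basis A X"
proof (cases "U \<inter> V = {}")
  case False
  then obtain z where z: "z \<in> U" "z \<in> V" by blast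
  have ab: "\<alpha> ! i = \<beta> ! i" if "i < length \<alpha>" for i
  proof -
    have "letter z i = \<alpha> ! i" "letter z i = \<beta> ! i"
      using z le that by (auto simp: assms(1,2) otw_cylinder_def begins_with_iff)
    then show ?thesis by simp
  qed
  show ?thesis
  proof (cases "length \<alpha> = length \<beta>")
    case True
    with ab have "\<alpha> = \<beta>" by (simp add: nth_equalityI)
    then have "U \<inter> V = otw_cylinder A X \<alpha> (G \<union> H)"
      by (auto simp: assms(1,2) otw_cylinder_def)
    then show ?thesis using fin by (simp add: otw_basisI del: in_lists_conv_set)
  next
    case False
    with le have lt: "length \<alpha> < length \<beta>" by simp
    have len: "enat (length \<alpha>) < wlen y" if "begins_with y \<beta>" for y
      using that lt order_less_le_trans[of "enat (length \<alpha>)" "enat (length \<beta>)" "wlen y"]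
      by (auto simp: begins_with_iff)
    have nG: "\<beta> ! length \<alpha> \<notin> G"
      using z lt len[of z] by (auto simp: assms(1,2) otw_cylinder_def begins_with_iff)
    have "V \<subseteq> U"
    proof
      fix y assume y: "y \<in> V"
      then have "begins_with y \<beta>" by (auto simp: assms(1,2) otw_cylinder_def)
      with y nG lt ab len[of y] show "y \<in> U"
        by (auto simp: assms(1,2) otw_cylinder_def begins_with_iff)
    qed
    then have "U \<inter> V = V" by blast
    then show ?thesis using fin assms(2) by (simp add: otw_basisI del: in_lists_conv_set)
  qed
qed simp

lemma openin_otw_topology:
  "openin (otw_topology A X) = arbitrary union_of (\<lambda>U. U \<in> otw_basis A X)"
proof -
  have "(arbitrary union_of (\<lambda>U. U \<in> otw_basis A X)) (U \<inter> V)"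
    if UV: "U \<in> otw_basis A X" "V \<in> otw_basis A X" for U V
  proof -
    have "U \<inter> V = {} \<or> U \<inter> V \<in> otw_basis A X"
    proof -
      obtain \<alpha> G \<beta> H where *:
        "U = otw_cylinder A X \<alpha> G" "V = otw_cylinder A X \<beta> H"
        "\<alpha> \<in> lists A" "\<beta> \<in> lists A" "finite G" "G \<subseteq> A" "finite H" "H \<subseteq> A"
        using UV unfolding otw_basis_def by blast
      show ?thesis
        using otw_cylinder_Int_aux[of U A X \<alpha> G V \<beta> H] otw_cylinder_Int_aux[of V A X \<beta> H U \<alpha> G] *
        by (metis Int_commute nat_le_linear)
    qed
    then show ?thesis
      by (metis arbitrary_union_of_empty arbitrary_union_of_inc)
  qed
  then have "istopology (arbitrary union_of (\<lambda>U. U \<in> otw_basis A X))"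
    by (simp add: istopology_base_eq)
  then show ?thesis by (simp add: otw_topology_def topology_inverse')
qed

lemma topspace_otw_topology: "topspace (otw_topology A X) = otw A X"
proof -
  have "otw_cylinder A X [] {} = otw A X"
    by (auto simp: otw_cylinder_def begins_with_iff zero_enat_def[symmetric])
  then have "otw A X \<in> otw_basis A X" using otw_basisI[of "[]" A "{}" X] by simp
  then have "openin (otw_topology A X) (otw A X)"
    by (simp add: openin_otw_topology arbitrary_union_of_inc)
  moreover have "S \<subseteq> otw A X" if "openin (otw_topology A X) S" for S
    using that by (fastforce simp: openin_otw_topology union_of_def otw_basis_def otw_cylinder_def)
  ultimately show ?thesis unfolding topspace_def by blast
qed

definition otw_conjugate :: "'a set \<Rightarrow> 'a word set \<Rightarrow> 'b set \<Rightarrow> 'b word set \<Rightarrow> bool" where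
  "otw_conjugate A X B Y \<longleftrightarrow>
     (\<exists>f. homeomorphic_map (otw_topology A X) (otw_topology B Y) f \<and>
          (\<forall>x\<in>otw A X. f (otw_shift x) = otw_shift (f x)) \<and>
          (\<forall>x\<in>otw A X. wlen (f x) = wlen x))"

section \<open>The metric and isometric conjugacy\<close>

definition seq_dist :: "'a word \<Rightarrow> 'a word \<Rightarrow> real" where
  "seq_dist x y = (if x = y then 0 else 1 / 2 ^ (LEAST i. x i \<noteq> y i))"

definition induces_product_topology :: "'a set \<Rightarrow> 'a word set \<Rightarrow> bool" where
  "induces_product_topology A X \<longleftrightarrow>
     Metric_space X seq_dist \<and>
     Metric_space.mtopology X seq_dist =
       subtopology (product_topology (\<lambda>_. discrete_topology A) UNIV) X"

definition isometric_conjugacy :: "'a word set \<Rightarrow> 'b word set \<Rightarrow> ('a word \<Rightarrow> 'b word) \<Rightarrow> bool" where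
  "isometric_conjugacy X Y f \<longleftrightarrow>
     bij_betw f X Y \<and>
     (\<forall>x\<in>X. \<forall>y\<in>X. seq_dist (f x) (f y) = seq_dist x y) \<and>
     (\<forall>x\<in>X. f (shift x) = shift (f x))"

section \<open>The two subshifts\<close>

abbreviation pos_nats :: "nat set" where
  "pos_nats \<equiv> {1..}"

definition P1 :: "nat list set" where
  "P1 = {[1, j, 1] |j. j \<in> pos_nats - {2}} \<union> {[j, 1, j] |j. j \<in> pos_nats - {2}} \<union>
        {[j, j + 1, j + 2] |j. j \<in> pos_nats}"

definition X1 :: "nat word set" where
  "X1 = subshift_of pos_nats ({w \<in> lists pos_nats. length w = 3} - P1)"

text \<open>
  The sequence \<open>(k + j)\<close> with \<open>j = 1, 2, \<dots>\<close> is re-indexed from \<open>0\<close>, via \<open>j = Suc i\<close>.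
\<close>

definition X2 :: "int word set" where
  "X2 = {(\<lambda>i. k + int (Suc i)) |k. True}"

end

theory Submission
  imports Defs
begin

text \<open>
  The constant sequence 1 is a fixed point of the shift in \<open>X1\<close>, as \<open>(1, 1, 1) \<in> P\<close>, whereas the shift
  on \<open>X2\<close> raises every letter by 1. A length-preserving conjugacy of the OTW-subshifts restricts to a
  shift-commuting map from \<open>X1\<close> to \<open>X2\<close>, so either kind of conjugacy would carry a fixed point
  of \<open>X1\<close> to one of \<open>X2\<close>.
\<close>

text \<open>With \<open>m\<close> the first index of disagreement, the distance is exactly 2^(-m),
  so the strict bound says \<open>n < m\<close>. Open balls of radius 2^(-n) thus become cylinders
  fixing the letters 0 to \<open>n\<close>.\<close>

lemma seq_dist_less_iff: "seq_dist x y < 1 / 2 ^ n \<longleftrightarrow> (\<forall>i\<le>n. x i = y i)"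
proof (cases "x = y")
  case False
  define m where "m = (LEAST i. x i \<noteq> y i)"
  have "\<exists>i. x i \<noteq> y i" using False by auto
  then have m: "x m \<noteq> y m" unfolding m_def by (rule LeastI_ex)
  have below: "x i = y i" if "i < m" for i using not_less_Least[of i] that by (auto simp: m_def)
  have "seq_dist x y < 1 / 2 ^ n \<longleftrightarrow> n < m"
    using False by (simp add: seq_dist_def flip: m_def) (simp add: divide_simps)
  also have "\<dots> \<longleftrightarrow> (\<forall>i\<le>n. x i = y i)" using m below by (meson le_less_trans not_le)
  finally show ?thesis .
qed (simp add: seq_dist_def)

lemma Metric_space_seq_dist: "Metric_space X seq_dist"
proof
  fix x y z :: "'a word"
  show "0 \<le> seq_dist x y" by (simp add: seq_dist_def)
  show "seq_dist x y = seq_dist y x" by (simp add: seq_dist_def eq_commute)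
  show "seq_dist x y = 0 \<longleftrightarrow> x = y" by (simp add: seq_dist_def)
  show "seq_dist x z \<le> seq_dist x y + seq_dist y z"
  proof (cases "x = z")
    case False
    define n where "n = (LEAST i. x i \<noteq> z i)"
    have "\<exists>i. x i \<noteq> z i" using False by auto
    then have "x n \<noteq> z n" unfolding n_def by (rule LeastI_ex)
    \<comment> \<open>The ultrametric argument: \<open>y\<close> cannot agree with both
      \<open>x\<close> and \<open>z\<close> at index \<open>n\<close>, so one of its two distances
      is already at least that from \<open>x\<close> to \<open>z\<close>.\<close>
    then have "\<not> seq_dist x y < 1 / 2 ^ n \<or> \<not> seq_dist y z < 1 / 2 ^ n"
      unfolding seq_dist_less_iff by (metis order_refl)
    moreover have "seq_dist x z = 1 / 2 ^ n" using False by (simp add: seq_dist_def n_def)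
    moreover have "0 \<le> seq_dist x y" "0 \<le> seq_dist y z" by (simp_all add: seq_dist_def)
    ultimately show ?thesis by linarith
  qed (simp add: seq_dist_def)
qed

text \<open>The cylinders fixing finitely many initial letters are a neighbourhood basis for both
  topologies: they are the balls of radius 2^(-n), and every basic box of the product restricts only
  finitely many coordinates.\<close>

lemma induces_product_topology:
  assumes X: "\<And>x. x \<in> X \<Longrightarrow> range x \<subseteq> A"
  shows "induces_product_topology A X"
proof -
  interpret Metric_space X seq_dist by (rule Metric_space_seq_dist)
  let ?T = "product_topology (\<lambda>_::nat. discrete_topology A) UNIV"
  have "openin mtopology S \<longleftrightarrow> openin (subtopology ?T X) S" for S
  proof
    assume S: "openin mtopology S"
    show "openin (subtopology ?T X) S"
    proof (subst openin_subopen, intro ballI)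
      fix x assume x: "x \<in> S"
      obtain r where r: "r > 0" "mball x r \<subseteq> S" using S x by (auto simp: openin_mtopology)
      obtain n where n: "1 / 2 ^ n < r"
        using real_arch_pow_inv[OF r(1), of "1/2"] by (auto simp: power_one_over)
      have xX: "x \<in> X" using S x by (auto simp: openin_mtopology)
      \<comment> \<open>This box, cut down to \<open>X\<close>, is the ball of radius 2^(-n) around
        \<open>x\<close>; it is open in the product because only the coordinates up to
        \<open>n\<close> can differ from \<open>A\<close>.\<close>
      define C where "C = Pi\<^sub>E UNIV (\<lambda>i. if i \<le> n then {x i} else A)"
      have "openin ?T C"
        unfolding C_def using X[OF xX]
        by (intro product_topology_basis) (auto intro: finite_subset[of _ "{..n}"])
      then have "openin (subtopology ?T X) (C \<inter> X)"
        unfolding openin_subtopology by blast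
      moreover have "x \<in> C \<inter> X" using X[OF xX] xX by (auto simp: C_def)
      moreover have "C \<inter> X \<subseteq> S"
      proof
        fix y assume y: "y \<in> C \<inter> X"
        have "x i = y i" if "i \<le> n" for i
        proof -
          from y have "y i \<in> (if i \<le> n then {x i} else A)" unfolding C_def by blast
          with that show ?thesis by simp
        qed
        then have "seq_dist x y < 1 / 2 ^ n" by (simp add: seq_dist_less_iff)
        with n y xX r(2) show "y \<in> S" by (auto simp: subset_iff)
      qed
      ultimately show "\<exists>U. openin (subtopology ?T X) U \<and> x \<in> U \<and> U \<subseteq> S" by blast
    qed
  next
    assume "openin (subtopology ?T X) S"
    then obtain V where V: "openin ?T V" "S = V \<inter> X" by (auto simp: openin_subtopology)
    show "openin mtopology S"
      unfolding openin_mtopology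
    proof (intro conjI allI impI)
      fix x assume x: "x \<in> S"
      then have "x \<in> V" using V by simp
      then obtain U where U: "finite {i. U i \<noteq> A}" "x \<in> Pi\<^sub>E UNIV U" "Pi\<^sub>E UNIV U \<subseteq> V"
        using V(1) by (fastforce simp: openin_product_topology_alt)
      \<comment> \<open>All coordinates restricted by the box lie at or below \<open>n\<close>, so
        agreement with \<open>x\<close> up to \<open>n\<close> suffices to stay in it.\<close>
      obtain n where n: "\<And>i. U i \<noteq> A \<Longrightarrow> i \<le> n"
        using U(1) by (auto simp: finite_nat_set_iff_bounded_le)
      have "mball x (1 / 2 ^ n) \<subseteq> S"
      proof
        fix y assume "y \<in> mball x (1 / 2 ^ n)"
        then have y: "y \<in> X" "\<And>i. i \<le> n \<Longrightarrow> x i = y i"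
          by (auto simp: seq_dist_less_iff)
        have "y i \<in> U i" for i
        proof (cases "i \<le> n")
          case True
          have "x i \<in> U i" using U(2) by blast
          with y(2)[OF True] show ?thesis by simp
        next
          case False
          with n[of i] X[OF y(1)] show ?thesis by blast
        qed
        with U(3) y(1) V(2) show "y \<in> S" by (auto simp: PiE_iff)
      qed
      then show "\<exists>r>0. mball x r \<subseteq> S" by (intro exI[of _ "1 / 2 ^ n"]) auto
    qed (use V in auto)
  qed
  then show ?thesis
    by (simp add: induces_product_topology_def Metric_space_seq_dist topology_eq)
qed

lemma is_subshift_X1: "is_subshift pos_nats X1"
  unfolding is_subshift_def X1_def by (rule exI, rule conjI[OF _ refl]) auto

text \<open>Lying in \<open>X2\<close> is a condition on neighbouring letters only: each exceeds its
  predecessor by 1. Hence forbidding two-letter blocks is enough.\<close>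

lemma is_subshift_X2: "is_subshift UNIV X2"
proof -
  have "x \<in> X2 \<longleftrightarrow> (\<forall>i. x (Suc i) = x i + 1)" for x
  proof
    assume step: "\<forall>i. x (Suc i) = x i + 1"
    \<comment> \<open>The parameter is \<open>x 0 - 1\<close> because re-indexing from 0 makes the
      first letter \<open>k + 1\<close>.\<close>
    have "x i = (x 0 - 1) + int (Suc i)" for i by (induction i) (use step in auto)
    then show "x \<in> X2" unfolding X2_def by blast
  qed (auto simp: X2_def)
  moreover have "occurs_in [a, b] x \<longleftrightarrow> (\<exists>i. x i = a \<and> x (Suc i) = b)" for a b and x :: "int word"
    by (simp add: occurs_in_def upt_rec)
  ultimately have "X2 = subshift_of UNIV {[a, b] |a b. b \<noteq> a + 1}"
    by (simp add: subshift_of_def set_eq_iff) metis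
  then show ?thesis unfolding is_subshift_def by auto
qed

text \<open>The only block of length 3 in this sequence is the case \<open>j = 1\<close> of
  \<open>[1, j, 1]\<close>, which the exclusion of 2 leaves in \<open>P1\<close>.\<close>

lemma const_1_in_X1: "(\<lambda>_. 1) \<in> X1"
proof -
  have "[1, 1, 1] \<in> P1" unfolding P1_def by force
  moreover have "w = [1, 1, 1]" if "occurs_in w (\<lambda>_. 1)" "length w = 3" for w :: "nat list"
    using that by (auto simp: occurs_in_def upt_rec numeral_eq_Suc)
  ultimately show ?thesis by (auto simp: X1_def subshift_of_def)
qed

lemma shift_const: "shift (\<lambda>_. c) = (\<lambda>_. c)"
  by (simp add: shift_def suffix_def)

lemma shift_neq_X2: "x \<in> X2 \<Longrightarrow> shift x \<noteq> x"
proof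
  assume "x \<in> X2" "shift x = x"
  then obtain k where "x = (\<lambda>i. k + int (Suc i))" "x 1 = x 0"
    by (auto simp: X2_def shift_def dest: fun_cong[of _ _ 0])
  then show False by simp
qed

lemma not_otw_conjugate_X1_X2: "\<not> otw_conjugate pos_nats X1 UNIV X2"
proof
  assume "otw_conjugate pos_nats X1 UNIV X2"
  then obtain f where f: "homeomorphic_map (otw_topology pos_nats X1) (otw_topology UNIV X2) f"
      "\<And>x. x \<in> otw pos_nats X1 \<Longrightarrow> f (otw_shift x) = otw_shift (f x)"
      "\<And>x. x \<in> otw pos_nats X1 \<Longrightarrow> wlen (f x) = wlen x"
    unfolding otw_conjugate_def by blast
  let ?c = "Infw (\<lambda>_. 1)"
  have c: "?c \<in> otw pos_nats X1" using const_1_in_X1 by (simp add: otw_def)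
  have "f ?c \<in> otw UNIV X2"
    using homeomorphic_imp_surjective_map[OF f(1)] c by (auto simp: topspace_otw_topology)
  \<comment> \<open>Length preservation excludes the empty word, which also lies in
    \<open>otw UNIV X2\<close> and is fixed by \<open>otw_shift\<close>.\<close>
  moreover have "wlen (f ?c) = \<infinity>" using f(3)[OF c] by simp
  ultimately obtain y where y: "y \<in> X2" "f ?c = Infw y" by (auto simp: otw_def)
  then have "shift y = y" using f(2)[OF c] by (simp add: shift_const)
  with shift_neq_X2 y(1) show False by blast
qed

lemma not_isometric_conjugacy_X1_X2: "\<not> isometric_conjugacy X1 X2 f"
proof
  assume f: "isometric_conjugacy X1 X2 f"
  then have "f (\<lambda>_. 1) \<in> X2"
    using const_1_in_X1 by (auto simp: isometric_conjugacy_def bij_betw_def)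
  moreover have "shift (f (\<lambda>_. 1)) = f (\<lambda>_. 1)"
    using f const_1_in_X1 by (auto simp: isometric_conjugacy_def shift_const dest: bspec)
  ultimately show False using shift_neq_X2 by blast
qed

theorem corollary5p18:
  shows "is_subshift pos_nats X1 \<and> is_subshift (UNIV :: int set) X2 \<and>
    \<not> otw_conjugate pos_nats X1 (UNIV :: int set) X2 \<and>
    induces_product_topology pos_nats X1 \<and>
    induces_product_topology (UNIV :: int set) X2 \<and>
    \<not> (\<exists>f. isometric_conjugacy X1 X2 f)"
proof -
  have "induces_product_topology pos_nats X1"
    by (rule induces_product_topology) (simp add: X1_def subshift_of_def)
  moreover have "induces_product_topology UNIV X2"
    by (rule induces_product_topology) simp
  ultimately show ?thesis
    using is_subshift_X1 is_subshift_X2 not_otw_conjugate_X1_X2 not_isometric_conjugacy_X1_X2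
    by blast
qed

end
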